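(* Let $k\ge 2$ be an integer. Then $$\alpha_k=\frac{2k-6k^3+4k^4-k\sqrt{4k-1}+4k^2\sqrt{4k-1}}{(2k^2+1)^2}$$ is not a jump for $r=3$.
   Context: An $r$-uniform graph $G$ is a finite set $V(G)$ of vertices together with a set $E(G)\subseteq\binom{V(G)}{r}$ of edges, where $\binom{V}{r}$ denotes the family of all $r$-subsets of $V$. Its density is $d(G)=|E(G)|/\binom{|V(G)|}{r}$. A real number $\alpha\in[0,1)$ is a jump for an integer $r\ge 2$ if there exists a constant $c>0$ such that for any $\epsilon>0$ and any integer $m\ge r$ there exists an integer $n_0(\epsilon,m)$ such that any $r$-uniform graph with $n>n_0(\epsilon,m)$ vertices and density $\ge\alpha+\epsilon$ contains a subgraph with $m$ vertices and density $\ge\alpha+c$. A number in $[0,1)$ that is not a jump for $r$ is called a non-jump for $r$. *)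

theory Defs
  imports Complex_Main "HOL-Library.Ramsey"
begin

definition uniform_graph :: "nat \<Rightarrow> 'a set \<Rightarrow> 'a set set \<Rightarrow> bool" where
  "uniform_graph r V E \<longleftrightarrow> finite V \<and> E \<subseteq> nsets V r"

definition density :: "nat \<Rightarrow> 'a set \<Rightarrow> 'a set set \<Rightarrow> real" where
  "density r V E = real (card E) / real (card V choose r)"

(* Subgraphs are not required to be induced. *)
definition subgraph_of ::
  "nat \<Rightarrow> 'a set \<Rightarrow> 'a set set \<Rightarrow> 'a set \<Rightarrow> 'a set set \<Rightarrow> bool" where
  "subgraph_of r W F V E \<longleftrightarrow> uniform_graph r W F \<and> W \<subseteq> V \<and> F \<subseteq> E"

(* The vertices are natural numbers because a definition cannot quantify over types;
   every finite graph is isomorphic to one of these. *)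
definition jump :: "nat \<Rightarrow> real \<Rightarrow> bool" where
  "jump r \<alpha> \<longleftrightarrow> 2 \<le> r \<and> 0 \<le> \<alpha> \<and> \<alpha> < 1 \<and>
     (\<exists>c>0. \<forall>\<epsilon>>0. \<forall>m\<ge>r. \<exists>n\<^sub>0::nat. \<forall>(V :: nat set) E.
        uniform_graph r V E \<and> card V > n\<^sub>0 \<and> density r V E \<ge> \<alpha> + \<epsilon> \<longrightarrow>
        (\<exists>W F. subgraph_of r W F V E \<and> card W = m \<and> density r W F \<ge> \<alpha> + c))"

(* The side conditions are repeated so that a number outside [0,1) is not a non-jump. *)
definition non_jump :: "nat \<Rightarrow> real \<Rightarrow> bool" where
  "non_jump r \<alpha> \<longleftrightarrow> 2 \<le> r \<and> 0 \<le> \<alpha> \<and> \<alpha> < 1 \<and> \<not> jump r \<alpha>"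

end

theory Submission
  imports Defs "HOL-Analysis.Convex"
begin

text \<open>
  Write \<open>\<lambda>(E, w)\<close> for the sum, over the edges of \<open>E\<close>, of the products of the vertex weights.  A blow-up
  of a 3-graph with part sizes proportional to weights \<open>w\<close> of total 1 has density close to
  \<open>6 \<lambda>(E, w)\<close>, and any \<open>M\<close> vertices of a blow-up lie over at most \<open>M\<close> vertices of the original graph.
  Hence \<open>\<alpha>\<close> is a non-jump as soon as, for each \<open>M\<close>, some 3-graph has weights with \<open>6 \<lambda> > \<alpha>\<close> while
  all weights supported on at most \<open>M\<close> vertices give \<open>6 \<lambda> \<le> \<alpha>\<close> (\<open>non_jump_criterion\<close>, an idea of
  Frankl and Roedl): the density gain over \<open>\<alpha>\<close> is invisible to small subgraphs.

  The number in question comes from a pattern on \<open>m = 2k\<close> parts, between which all triples meeting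
  three parts are edges, and one further part \<open>B\<close>: all triples with at most two vertices
  in \<open>B\<close> and at most one in each other part are edges.  With weight \<open>x\<close> spread evenly over
  the \<open>m\<close> parts, weight \<open>1 - x\<close> on \<open>B\<close>, and \<open>b = 1/m\<close>, its density is the cubic
  \<open>(1 - b)(1 - 2b)x^3 + 3(1 - b)x^2(1 - x) + 3x(1 - x)^2\<close>.  The maximum of this cubic on \<open>[0, 1]\<close> is
  attained at the smaller root of its derivative, which is where the square root
  \<open>sqrt(2b - b^2) = sqrt(4k - 1)/(2k)\<close> comes from, and its maximal value is \<open>\<alpha>\<^sub>k\<close>.

  If \<open>B\<close> is split into \<open>t\<close> single vertices then the pattern becomes a genuine 3-graph, at the price
  of a loss of order \<open>1/t\<close> in the density.  A triple system \<open>F\<close> with \<open>C t^2\<close> edges inside \<open>B\<close> also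
  contributes order \<open>1/t\<close>, and more than the loss if \<open>C\<close> is large.  The deletion method
  provides such an \<open>F\<close> in which any \<open>s \<le> M\<close> vertices span at most \<open>s - 2\<close> edges
  (\<open>sparse_triple_system_exists\<close>).

  For weights supported on at most \<open>M\<close> vertices this sparsity bounds the contribution of \<open>F\<close>
  by that of the star-like system of all triples containing the two heaviest vertices of \<open>B\<close>
  (\<open>heaviest_two_bound\<close>).  This is compared with the loss \<open>3x\<close> times the sum of the squared weights
  in \<open>B\<close>: with \<open>s\<close> the total weight of the two heaviest vertices, the net gain over the cubic is at
  most \<open>(3/2) s^2 (1 - 2x - s)\<close>.  For \<open>x \<ge> 1/2\<close> this is not positive.  For \<open>x < 1/2\<close> it is at most
  \<open>(2/9)(1 - 2x)^3\<close>, and as soon as \<open>m \<ge> 4\<close> the cubic rises between \<open>x\<close> and \<open>1/2\<close> by at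
  least that amount (\<open>cubic_perturbed_le_peak\<close>).
\<close>

section \<open>Weighted edge sums\<close>

definition lagrangian :: "'a set set \<Rightarrow> ('a \<Rightarrow> real) \<Rightarrow> real" where
  "lagrangian E w = (\<Sum>e\<in>E. \<Prod>v\<in>e. w v)"

lemma lagrangian_scale:
  assumes "E \<subseteq> nsets V r"
  shows "lagrangian E (\<lambda>v. c * w v) = c ^ r * lagrangian E w"
proof -
  have "(\<Prod>v\<in>e. c * w v) = c ^ r * (\<Prod>v\<in>e. w v)" if "e \<in> E" for e
    using assms that by (auto simp: prod.distrib nsets_def)
  then show ?thesis by (simp add: lagrangian_def sum_distrib_left)
qed

section \<open>A criterion for non-jumps\<close>

text \<open>
  A transversal is the image of a unique choice function for the fibres over \<open>e\<close>.
\<close>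
lemma card_transversals:
  fixes \<pi> :: "'b \<Rightarrow> 'a"
  assumes "finite X" "finite e"
  shows "card {S. S \<subseteq> X \<and> inj_on \<pi> S \<and> \<pi> ` S = e} = (\<Prod>v\<in>e. card {x\<in>X. \<pi> x = v})"
proof -
  have "bij_betw (\<lambda>f. f ` e) (Pi\<^sub>E e (\<lambda>v. {x\<in>X. \<pi> x = v})) {S. S \<subseteq> X \<and> inj_on \<pi> S \<and> \<pi> ` S = e}"
    unfolding bij_betw_def
  proof (intro conjI equalityI subsetI)
    show "inj_on (\<lambda>f. f ` e) (Pi\<^sub>E e (\<lambda>v. {x\<in>X. \<pi> x = v}))"
    proof (rule inj_onI)
      fix f g assume f: "f \<in> Pi\<^sub>E e (\<lambda>v. {x\<in>X. \<pi> x = v})" and g: "g \<in> Pi\<^sub>E e (\<lambda>v. {x\<in>X. \<pi> x = v})"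
        and eq: "f ` e = g ` e"
      have "f v = g v" if "v \<in> e" for v
      proof -
        from eq that have "f v \<in> g ` e" by blast
        then obtain w where w: "w \<in> e" "f v = g w" by blast
        have "\<pi> (f v) = v" "\<pi> (g w) = w" using PiE_mem[OF f that] PiE_mem[OF g w(1)] by auto
        with w show ?thesis by simp
      qed
      then show "f = g" using f g by (rule PiE_ext[rotated 2])
    qed
  next
    fix S assume "S \<in> (\<lambda>f. f ` e) ` Pi\<^sub>E e (\<lambda>v. {x\<in>X. \<pi> x = v})"
    then obtain f where f: "f \<in> Pi\<^sub>E e (\<lambda>v. {x\<in>X. \<pi> x = v})" and S: "S = f ` e" by blast
    have "f v \<in> X" "\<pi> (f v) = v" if "v \<in> e" for v using PiE_mem[OF f that] by auto
    then show "S \<in> {S. S \<subseteq> X \<and> inj_on \<pi> S \<and> \<pi> ` S = e}"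
      unfolding S by (auto simp: inj_on_def image_image)
  next
    fix S assume "S \<in> {S. S \<subseteq> X \<and> inj_on \<pi> S \<and> \<pi> ` S = e}"
    then have S: "S \<subseteq> X" "inj_on \<pi> S" "\<pi> ` S = e" by auto
    define f where "f = restrict (the_inv_into S \<pi>) e"
    have f_\<pi>: "f (\<pi> x) = x" if "x \<in> S" for x
      using S that unfolding f_def by (simp add: the_inv_into_f_f[OF S(2)] flip: S(3))
    have "f ` e = S" using f_\<pi> unfolding S(3)[symmetric] image_image by simp
    moreover have "f \<in> Pi\<^sub>E e (\<lambda>v. {x\<in>X. \<pi> x = v})"
    proof (rule PiE_I)
      fix v assume "v \<in> e"
      then obtain x where x: "x \<in> S" "v = \<pi> x" using S(3) by blast
      then show "f v \<in> {x\<in>X. \<pi> x = v}" using f_\<pi>[OF x(1)] S(1) by auto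
    qed (simp add: f_def)
    ultimately show "S \<in> (\<lambda>f. f ` e) ` Pi\<^sub>E e (\<lambda>v. {x\<in>X. \<pi> x = v})" by blast
  qed
  then have "card {S. S \<subseteq> X \<and> inj_on \<pi> S \<and> \<pi> ` S = e} = card (Pi\<^sub>E e (\<lambda>v. {x\<in>X. \<pi> x = v}))"
    by (rule bij_betw_same_card[symmetric])
  then show ?thesis using assms(2) by (simp add: card_PiE)
qed

text \<open>
  Here \<open>\<pi>\<close> sends a vertex of the blow-up to the vertex that it is a copy of.
\<close>
definition blowup :: "('b \<Rightarrow> 'a) \<Rightarrow> 'b set \<Rightarrow> 'a set set \<Rightarrow> 'b set set" where
  "blowup \<pi> X E = {S. S \<subseteq> X \<and> inj_on \<pi> S \<and> \<pi> ` S \<in> E}"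

lemma card_blowup:
  assumes "finite X" "finite E" "\<And>e. e \<in> E \<Longrightarrow> finite e"
  shows "real (card (blowup \<pi> X E)) = lagrangian E (\<lambda>v. real (card {x\<in>X. \<pi> x = v}))"
proof -
  have "blowup \<pi> X E = (\<Union>e\<in>E. {S. S \<subseteq> X \<and> inj_on \<pi> S \<and> \<pi> ` S = e})"
    by (auto simp: blowup_def)
  also have "card \<dots> = (\<Sum>e\<in>E. card {S. S \<subseteq> X \<and> inj_on \<pi> S \<and> \<pi> ` S = e})"
  proof (rule card_UN_disjoint)
    show "\<forall>e\<in>E. finite {S. S \<subseteq> X \<and> inj_on \<pi> S \<and> \<pi> ` S = e}"
      using assms(1) by simp
  qed (use assms(2) in auto)
  also have "\<dots> = (\<Sum>e\<in>E. \<Prod>v\<in>e. card {x\<in>X. \<pi> x = v})"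
    using assms by (intro sum.cong refl card_transversals) auto
  finally show ?thesis by (simp only: lagrangian_def of_nat_sum of_nat_prod)
qed

text \<open>
  Blow-ups are thereby available on an initial segment of the natural numbers.
\<close>
lemma exists_map_with_fibre_sizes:
  fixes n :: "'a \<Rightarrow> nat"
  assumes "finite V"
  shows "\<exists>\<pi>. (\<forall>x<sum n V. \<pi> x \<in> V) \<and> (\<forall>v\<in>V. card {x\<in>{..<sum n V}. \<pi> x = v} = n v)"
proof -
  define S where "S = (SIGMA v:V. {..<n v})"
  have S: "finite S" "card S = sum n V" using assms by (auto simp: S_def)
  then obtain h where h: "bij_betw h {..<sum n V} S"
    by (metis atLeast0LessThan ex_bij_betw_nat_finite)
  have "card {x\<in>{..<sum n V}. fst (h x) = v} = n v" if "v \<in> V" for v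
  proof -
    have "bij_betw h {x\<in>{..<sum n V}. fst (h x) = v} {s\<in>S. fst s = v}"
      using h unfolding bij_betw_def by (auto intro: inj_on_subset)
    then have "card {x\<in>{..<sum n V}. fst (h x) = v} = card {s\<in>S. fst s = v}"
      by (rule bij_betw_same_card)
    also have "{s\<in>S. fst s = v} = {v} \<times> {..<n v}" using that by (auto simp: S_def)
    finally show ?thesis by simp
  qed
  moreover have "fst (h x) \<in> V" if "x < sum n V" for x
    using bij_betwE[OF h] that by (force simp: S_def)
  ultimately show ?thesis by (intro exI[of _ "fst \<circ> h"]) auto
qed

lemma fact_binomial_le_power:
  "fact r * real (n choose r) \<le> real n ^ r"
  using binomial_fact_pow[of n r]
  by (metis mult.commute of_nat_fact of_nat_le_iff of_nat_mult of_nat_power)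

lemma fact_binomial_over_power_tendsto:
  "(\<lambda>n. fact r * real (n choose r) / real n ^ r) \<longlonglongrightarrow> 1"
proof -
  have "fact r * real (n choose r) / real n ^ r = (\<Prod>i<r. 1 - real i / real n)" if "n > 0" for n
  proof -
    have "fact r * real (n choose r) = (\<Prod>i<r. real n - real i)"
      using binomial_gbinomial[of n r, where 'a = real]
      by (simp add: gbinomial_prod_rev atLeast0LessThan)
    also have "\<dots> / real n ^ r = (\<Prod>i<r. (real n - real i) / real n)"
      by (simp add: prod_dividef)
    also have "\<dots> = (\<Prod>i<r. 1 - real i / real n)"
      using that by (intro prod.cong) (auto simp: diff_divide_distrib)
    finally show ?thesis .
  qed
  then have "\<forall>\<^sub>F n in sequentially. (\<Prod>i<r. 1 - real i / real n) = fact r * real (n choose r) / real n ^ r"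
    by (intro eventually_sequentiallyI[of 1]) simp
  moreover have "(\<lambda>n. \<Prod>i<r. 1 - real i / real n) \<longlonglongrightarrow> (\<Prod>i<r. 1 - 0)"
    by (intro tendsto_prod tendsto_diff tendsto_const lim_const_over_n)
  ultimately show ?thesis by (simp add: Lim_transform_eventually)
qed

text \<open>
  Given a gap \<open>c\<close>, the size \<open>m\<close> of the subgraphs is chosen so large that density \<open>\<alpha> + c\<close> on \<open>m\<close>
  vertices forces the relative part sizes of the subgraph to be weights with \<open>r! \<lambda> > \<alpha>\<close>; a blow-up
  of the graph supplied for this \<open>m\<close> excludes that.  The excess of \<open>r! \<lambda>\<close> over \<open>\<alpha>\<close> on that graph depends
  on \<open>m\<close>, which is harmless, since \<open>\<epsilon>\<close> may depend on \<open>c\<close>.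
\<close>
theorem non_jump_criterion:
  fixes \<alpha> :: real
  assumes r: "2 \<le> r" and \<alpha>: "0 \<le> \<alpha>" "\<alpha> < 1"
    and pattern: "\<And>M. \<exists>(V :: 'a set) E w. uniform_graph r V E \<and>
          (\<forall>v\<in>V. 0 \<le> w v) \<and> sum w V = 1 \<and> \<alpha> < fact r * lagrangian E w \<and>
          (\<forall>u. (\<forall>v\<in>V. 0 \<le> u v) \<longrightarrow> sum u V = 1 \<longrightarrow> card {v\<in>V. u v \<noteq> 0} \<le> M
             \<longrightarrow> fact r * lagrangian E u \<le> \<alpha>)"
  shows "non_jump r \<alpha>"
proof -
  have gap: "\<exists>\<epsilon>>0. \<exists>m\<ge>r. \<forall>n\<^sub>0. \<exists>(X :: nat set) H. uniform_graph r X H \<and> card X > n\<^sub>0 \<and>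
      density r X H \<ge> \<alpha> + \<epsilon> \<and>
      (\<forall>W F. subgraph_of r W F X H \<longrightarrow> card W = m \<longrightarrow> density r W F < \<alpha> + c)" if c: "c > 0" for c
  proof -
    \<comment> \<open>\<open>(m choose r)\<close> times \<open>r!\<close> is asymptotic to \<open>m^r\<close>, so density \<open>\<alpha> + c\<close> will force \<open>r! \<lambda> > \<alpha>\<close>\<close>
    have "(\<lambda>n. (\<alpha> + c) * (fact r * real (n choose r) / real n ^ r)) \<longlonglongrightarrow> (\<alpha> + c) * 1"
      by (intro tendsto_intros fact_binomial_over_power_tendsto)
    then have "\<forall>\<^sub>F n in sequentially. \<alpha> < (\<alpha> + c) * (fact r * real (n choose r) / real n ^ r)"
      using c by (intro order_tendstoD(1)) auto
    then have "\<forall>\<^sub>F n in sequentially. r \<le> n \<and> \<alpha> < (\<alpha> + c) * (fact r * real (n choose r) / real n ^ r)"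
      by (intro eventually_conj eventually_ge_at_top)
    then obtain m where m: "r \<le> m" "\<alpha> < (\<alpha> + c) * (fact r * real (m choose r) / real m ^ r)"
      using eventually_happens by force
    obtain V :: "'a set" and E w where G: "uniform_graph r V E" and w: "\<forall>v\<in>V. 0 \<le> w v" "sum w V = 1"
      and big: "\<alpha> < fact r * lagrangian E w"
      and small: "\<And>u. (\<forall>v\<in>V. 0 \<le> u v) \<Longrightarrow> sum u V = 1 \<Longrightarrow> card {v\<in>V. u v \<noteq> 0} \<le> m
             \<Longrightarrow> fact r * lagrangian E u \<le> \<alpha>"
      using pattern[of m] by blast
    have V: "finite V" and E: "E \<subseteq> nsets V r" using G by (auto simp: uniform_graph_def)
    have finE: "finite E" using V E finite_subset finite_imp_finite_nsets by blast
    have fine: "finite e" "e \<subseteq> V" if "e \<in> E" for e using E that by (auto simp: nsets_def)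
    define \<epsilon> where "\<epsilon> = (fact r * lagrangian E w - \<alpha>) / 2"
    have \<epsilon>: "\<epsilon> > 0" using big by (simp add: \<epsilon>_def)
    have "\<exists>(X :: nat set) H. uniform_graph r X H \<and> card X > n\<^sub>0 \<and> density r X H \<ge> \<alpha> + \<epsilon> \<and>
      (\<forall>W F. subgraph_of r W F X H \<longrightarrow> card W = m \<longrightarrow> density r W F < \<alpha> + c)" for n\<^sub>0
    proof -
      define n where "n N v = nat \<lfloor>real N * w v\<rfloor>" for N :: nat and v
      have n_le: "real (n N v) \<le> real N * w v" if "v \<in> V" for N v
        using w that by (simp add: n_def)
      have n_ge: "real N * w v - 1 \<le> real (n N v)" for N v
        unfolding n_def by linarith
      have total_le: "real (sum (n N) V) \<le> real N" for N
      proof -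
        have "real (sum (n N) V) \<le> (\<Sum>v\<in>V. real N * w v)"
          using n_le by (simp add: sum_mono)
        then show ?thesis using w by (simp add: sum_distrib_left[symmetric])
      qed
      have total_ge: "real N - real (card V) \<le> real (sum (n N) V)" for N
      proof -
        have "(\<Sum>v\<in>V. real N * w v - 1) \<le> real (sum (n N) V)"
          using n_ge by (simp add: sum_mono)
        then show ?thesis using w by (simp add: sum_subtractf sum_distrib_left[symmetric])
      qed
      have "(\<lambda>N. real (n N v) / real N) \<longlonglongrightarrow> w v" if "v \<in> V" for v
      proof (rule tendsto_sandwich)
        show "\<forall>\<^sub>F N in sequentially. w v - 1 / real N \<le> real (n N v) / real N"
        proof (rule eventually_sequentiallyI[of 1])
          fix N :: nat assume "1 \<le> N"
          then have "w v - 1 / real N = (real N * w v - 1) / real N" by (simp add: diff_divide_distrib)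
          also have "\<dots> \<le> real (n N v) / real N" using n_ge by (rule divide_right_mono) simp
          finally show "w v - 1 / real N \<le> real (n N v) / real N" .
        qed
        show "\<forall>\<^sub>F N in sequentially. real (n N v) / real N \<le> w v"
          using n_le that by (intro eventually_sequentiallyI[of 1]) (simp add: field_simps)
        have "(\<lambda>N. w v - 1 / real N) \<longlonglongrightarrow> w v - 0"
          by (intro tendsto_diff tendsto_const lim_const_over_n)
        then show "(\<lambda>N. w v - 1 / real N) \<longlonglongrightarrow> w v" by simp
      qed simp
      then have "(\<lambda>N. fact r * lagrangian E (\<lambda>v. real (n N v) / real N)) \<longlonglongrightarrow> fact r * lagrangian E w"
        unfolding lagrangian_def using fine by (intro tendsto_mult tendsto_const tendsto_sum tendsto_prod) auto
      then have "\<forall>\<^sub>F N in sequentially. \<alpha> + \<epsilon> < fact r * lagrangian E (\<lambda>v. real (n N v) / real N)"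
        by (rule order_tendstoD(1)) (use big in \<open>simp add: \<epsilon>_def field_simps\<close>)
      then have "\<forall>\<^sub>F N in sequentially. n\<^sub>0 + card V + r + 1 \<le> N \<and>
          \<alpha> + \<epsilon> < fact r * lagrangian E (\<lambda>v. real (n N v) / real N)"
        by (intro eventually_conj eventually_ge_at_top)
      then obtain N where N: "n\<^sub>0 + card V + r + 1 \<le> N"
          "\<alpha> + \<epsilon> < fact r * lagrangian E (\<lambda>v. real (n N v) / real N)"
        using eventually_happens by force
      define k where "k = sum (n N) V"
      have k: "n\<^sub>0 < k" "r \<le> k" using total_ge[of N] N(1) unfolding k_def by linarith+
      obtain \<pi> where \<pi>: "\<And>x. x < k \<Longrightarrow> \<pi> x \<in> V" "\<And>v. v \<in> V \<Longrightarrow> card {x\<in>{..<k}. \<pi> x = v} = n N v"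
        using exists_map_with_fibre_sizes[OF V, of "n N"] unfolding k_def by blast
      define H where "H = blowup \<pi> {..<k} E"
      have H: "uniform_graph r {..<k} H"
      proof -
        have "S \<in> nsets {..<k} r" if "S \<in> H" for S
        proof -
          have S: "S \<subseteq> {..<k}" "inj_on \<pi> S" "\<pi> ` S \<in> E" using that by (auto simp: H_def blowup_def)
          then have "card S = r" using E card_image[OF S(2)] by (auto simp: nsets_def)
          then show ?thesis using S(1) finite_subset by (auto simp: nsets_def)
        qed
        then show ?thesis by (auto simp: uniform_graph_def)
      qed
      have "real (card H) = lagrangian E (\<lambda>v. real (card {x\<in>{..<k}. \<pi> x = v}))"
        unfolding H_def using finE fine by (intro card_blowup) auto
      also have "\<dots> = lagrangian E (\<lambda>v. real N * (real (n N v) / real N))"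
        unfolding lagrangian_def using fine \<pi>(2) N(1) by (intro sum.cong prod.cong refl) auto
      also have "\<dots> = real N ^ r * lagrangian E (\<lambda>v. real (n N v) / real N)"
        by (rule lagrangian_scale[OF E])
      finally have card_H: "real (card H) = real N ^ r * lagrangian E (\<lambda>v. real (n N v) / real N)" .
      have "density r {..<k} H \<ge> \<alpha> + \<epsilon>"
      proof -
        have "(\<alpha> + \<epsilon>) * (fact r * real (k choose r)) \<le> (\<alpha> + \<epsilon>) * real N ^ r"
        proof (rule mult_left_mono)
          have "real k ^ r \<le> real N ^ r"
            using total_le[of N] unfolding k_def by (intro power_mono) (simp_all only: of_nat_0_le_iff)
          then show "fact r * real (k choose r) \<le> real N ^ r"
            using fact_binomial_le_power[of r k] by linarith
        qed (use \<alpha> \<epsilon> in simp)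
        also have "\<dots> \<le> fact r * real (card H)"
          using mult_right_mono[OF less_imp_le[OF N(2)], of "real N ^ r"] unfolding card_H
          by (simp add: mult_ac)
        finally have "fact r * ((\<alpha> + \<epsilon>) * real (k choose r)) \<le> fact r * real (card H)"
          by (simp add: mult_ac)
        then show ?thesis using k by (simp add: density_def pos_le_divide_eq)
      qed
      moreover have "density r W F < \<alpha> + c" if sub: "subgraph_of r W F {..<k} H" and W: "card W = m" for W F
      proof -
        have sub': "W \<subseteq> {..<k}" "F \<subseteq> H" "F \<subseteq> nsets W r" using sub
          by (auto simp: subgraph_of_def uniform_graph_def)
        then have finW: "finite W" using finite_subset by blast
        have m0: "m > 0" using m(1) r by linarith
        \<comment> \<open>the relative part sizes of \<open>W\<close> are weights with small support\<close>
        define u where "u v = real (card {x\<in>W. \<pi> x = v}) / real m" for v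
        have "F \<subseteq> blowup \<pi> W E"
          using sub' by (auto simp: H_def blowup_def nsets_def)
        moreover have "finite (blowup \<pi> W E)"
          using finW by (auto simp: blowup_def)
        ultimately have "real (card F) \<le> real (card (blowup \<pi> W E))"
          by (simp add: card_mono)
        also have "\<dots> = lagrangian E (\<lambda>v. real m * u v)"
          using card_blowup[OF finW finE fine(1)] m0 by (simp add: u_def)
        also have "\<dots> = real m ^ r * lagrangian E u"
          by (rule lagrangian_scale[OF E])
        finally have "fact r * real (card F) \<le> real m ^ r * (fact r * lagrangian E u)"
          by (simp add: mult_ac)
        also have "\<dots> \<le> real m ^ r * \<alpha>"
        proof (intro mult_left_mono small)
          have W_union: "W = (\<Union>v\<in>V. {x\<in>W. \<pi> x = v})" using \<pi>(1) sub'(1) by auto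
          have "card W = (\<Sum>v\<in>V. card {x\<in>W. \<pi> x = v})"
            by (subst W_union, rule card_UN_disjoint) (use V finW in auto)
          then show "sum u V = 1"
            using W m0 by (simp add: u_def sum_divide_distrib[symmetric] of_nat_sum[symmetric] del: of_nat_sum)
          have "{v\<in>V. u v \<noteq> 0} \<subseteq> \<pi> ` W" using finW by (auto simp: u_def)
          then show "card {v\<in>V. u v \<noteq> 0} \<le> m"
            using W finW by (metis card_image_le card_mono finite_imageI order_trans)
        qed (auto simp: u_def)
        also have "\<dots> < fact r * ((\<alpha> + c) * real (m choose r))"
          using m(2) m0 by (simp add: field_simps)
        finally show ?thesis using m(1) W by (simp add: density_def pos_divide_less_eq)
      qed
      ultimately show ?thesis using H k by (intro exI[of _ "{..<k}"] exI[of _ H]) auto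
    qed
    then show ?thesis using \<epsilon> m(1) by blast
  qed
  have "\<not> jump r \<alpha>"
  proof
    assume "jump r \<alpha>"
    then obtain c where "c > 0"
      and jump: "\<And>\<epsilon> m. \<epsilon> > 0 \<Longrightarrow> r \<le> m \<Longrightarrow> \<exists>n\<^sub>0. \<forall>(X :: nat set) H.
        uniform_graph r X H \<and> card X > n\<^sub>0 \<and> density r X H \<ge> \<alpha> + \<epsilon> \<longrightarrow>
        (\<exists>W F. subgraph_of r W F X H \<and> card W = m \<and> density r W F \<ge> \<alpha> + c)"
      unfolding jump_def by blast
    obtain \<epsilon> m where \<epsilon>m: "\<epsilon> > 0" "r \<le> m"
      and sparse: "\<And>n\<^sub>0. \<exists>(X :: nat set) H. uniform_graph r X H \<and> card X > n\<^sub>0 \<and> density r X H \<ge> \<alpha> + \<epsilon> \<and>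
        (\<forall>W F. subgraph_of r W F X H \<longrightarrow> card W = m \<longrightarrow> density r W F < \<alpha> + c)"
      using gap[OF \<open>c > 0\<close>] by blast
    obtain n\<^sub>0 where n\<^sub>0: "\<forall>(X :: nat set) H.
        uniform_graph r X H \<and> card X > n\<^sub>0 \<and> density r X H \<ge> \<alpha> + \<epsilon> \<longrightarrow>
        (\<exists>W F. subgraph_of r W F X H \<and> card W = m \<and> density r W F \<ge> \<alpha> + c)"
      using jump[OF \<epsilon>m] by blast
    obtain X :: "nat set" and H where XH: "uniform_graph r X H" "card X > n\<^sub>0" "density r X H \<ge> \<alpha> + \<epsilon>"
      and low: "\<And>W F. subgraph_of r W F X H \<Longrightarrow> card W = m \<Longrightarrow> density r W F < \<alpha> + c"
      using sparse[of n\<^sub>0] by blast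
    obtain W F where "subgraph_of r W F X H" "card W = m" "density r W F \<ge> \<alpha> + c"
      using n\<^sub>0 XH by blast
    then show False using low by fastforce
  qed
  then show ?thesis using r \<alpha> by (simp add: non_jump_def)
qed

section \<open>Dense triple systems that are locally sparse\<close>

text \<open>
  If every element of \<open>R\<close> is added to \<open>S\<close> independently with probability \<open>p\<close>, then the left-hand side of
  the inequality is the expectation of the right-hand side.  Deciding one element at a time,
  always for the choice with the larger conditional expectation, reaches a \<open>T\<close> that is at least as
  good as the average.
\<close>
lemma conditional_expectations:
  fixes p :: real and B :: "'i \<Rightarrow> 'a set"
  assumes "finite R" "finite S" "finite I" "0 \<le> p" "p \<le> 1" "S \<inter> R = {}"
  shows "\<exists>T. T \<subseteq> S \<union> R \<and>
     real (card S) + p * real (card R) - (\<Sum>i\<in>I. if B i \<subseteq> S \<union> R then p ^ card (B i \<inter> R) else 0)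
       \<le> real (card T) - real (card {i\<in>I. B i \<subseteq> T})"
  using assms
proof (induction R arbitrary: S rule: finite_induct)
  case empty
  have "(\<Sum>i\<in>I. if B i \<subseteq> S then 1 else 0) = real (card {i\<in>I. B i \<subseteq> S})"
    using empty by (simp add: sum.If_cases Int_def)
  then show ?case by (intro exI[of _ S]) (auto cong: if_cong)
next
  case (insert x R)
  define val where "val S R = real (card S) + p * real (card R)
      - (\<Sum>i\<in>I. if B i \<subseteq> S \<union> R then p ^ card (B i \<inter> R) else 0)" for S R
  have x: "x \<notin> S" and disj: "S \<inter> R = {}" "insert x S \<inter> R = {}"
    using insert by auto
  have weight: "(if B i \<subseteq> S \<union> insert x R then p ^ card (B i \<inter> insert x R) else 0)
      = p * (if B i \<subseteq> insert x S \<union> R then p ^ card (B i \<inter> R) else 0)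
        + (1 - p) * (if B i \<subseteq> S \<union> R then p ^ card (B i \<inter> R) else 0)" for i
  proof (cases "x \<in> B i")
    case True
    then have "B i \<inter> insert x R = insert x (B i \<inter> R)" by auto
    then have "card (B i \<inter> insert x R) = Suc (card (B i \<inter> R))"
      using insert by simp
    moreover have "\<not> B i \<subseteq> S \<union> R" using True x insert by auto
    ultimately show ?thesis by auto
  next
    case False
    then have "B i \<inter> insert x R = B i \<inter> R" "B i \<subseteq> S \<union> insert x R \<longleftrightarrow> B i \<subseteq> S \<union> R"
      "B i \<subseteq> insert x S \<union> R \<longleftrightarrow> B i \<subseteq> S \<union> R" by auto
    then show ?thesis by (auto simp: algebra_simps)
  qed
  have "val S (insert x R) = p * val (insert x S) R + (1 - p) * val S R"
    unfolding val_def weight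
    using insert x by (simp add: sum.distrib sum_subtractf sum_distrib_left algebra_simps)
  moreover have "p * val (insert x S) R + (1 - p) * val S R \<le> max (val (insert x S) R) (val S R)"
    using convex_bound_le[of "val (insert x S) R" _ "val S R" p "1 - p"] insert.prems by auto
  ultimately consider "val S (insert x R) \<le> val (insert x S) R" | "val S (insert x R) \<le> val S R"
    by linarith
  then show ?case
  proof cases
    case 1
    from insert.IH[of "insert x S"] insert.prems disj obtain T where
      "T \<subseteq> insert x S \<union> R" "val (insert x S) R \<le> real (card T) - real (card {i\<in>I. B i \<subseteq> T})"
      unfolding val_def by auto
    with 1 show ?thesis unfolding val_def by (intro exI[of _ T]) auto
  next
    case 2
    from insert.IH[of S] insert.prems disj obtain T where
      "T \<subseteq> S \<union> R" "val S R \<le> real (card T) - real (card {i\<in>I. B i \<subseteq> T})"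
      unfolding val_def by auto
    with 2 show ?thesis unfolding val_def by (intro exI[of _ T]) auto
  qed
qed

text \<open>
  Removing one element of each bad set that lies inside the set provided by \<open>conditional_expectations\<close>
  costs no more than the number of these bad sets.
\<close>
lemma deletion_method:
  fixes p :: real and B :: "'i \<Rightarrow> 'a set"
  assumes "finite X" "finite I" "0 \<le> p" "p \<le> 1" "\<And>i. i \<in> I \<Longrightarrow> B i \<noteq> {}"
  shows "\<exists>S\<subseteq>X. (\<forall>i\<in>I. \<not> B i \<subseteq> S) \<and> p * real (card X) - (\<Sum>i\<in>I. p ^ card (B i)) \<le> real (card S)"
proof -
  obtain T where T: "T \<subseteq> X" and val: "p * real (card X)
      - (\<Sum>i\<in>I. if B i \<subseteq> X then p ^ card (B i \<inter> X) else 0)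
       \<le> real (card T) - real (card {i\<in>I. B i \<subseteq> T})"
    using conditional_expectations[of X "{}" I p B] assms by auto
  have "(\<Sum>i\<in>I. if B i \<subseteq> X then p ^ card (B i \<inter> X) else 0) \<le> (\<Sum>i\<in>I. p ^ card (B i))"
    using assms(3) by (intro sum_mono) (auto simp: Int_absorb2)
  moreover define D where "D = (\<lambda>i. SOME v. v \<in> B i) ` {i\<in>I. B i \<subseteq> T}"
  have "card D \<le> card {i\<in>I. B i \<subseteq> T}"
    unfolding D_def using assms(2) by (intro card_image_le) auto
  moreover have "finite D" unfolding D_def using assms(2) by auto
  have "card T - card D \<le> card (T - D)"
    using \<open>finite D\<close> by (simp add: diff_card_le_card_Diff)
  moreover have "\<not> B i \<subseteq> T - D" if "i \<in> I" for i
  proof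
    assume sub: "B i \<subseteq> T - D"
    moreover have "(SOME v. v \<in> B i) \<in> B i" using assms(5)[OF that] by (meson ex_in_conv someI_ex)
    ultimately show False using that unfolding D_def by blast
  qed
  ultimately show ?thesis
    using val T by (intro exI[of _ "T - D"]) auto
qed

lemma sum_over_Sigma:
  fixes h :: "'a \<times> 'b \<Rightarrow> real"
  assumes "finite A" "\<And>x. x \<in> A \<Longrightarrow> finite (B x)"
  shows "sum h (Sigma A B) = (\<Sum>x\<in>A. \<Sum>y\<in>B x. h (x, y))"
  using sum.Sigma[of A B "\<lambda>x y. h (x, y)"] assms by simp

text \<open>
  Triples are taken with probability \<open>p = c/t\<close>; a bad set consists of \<open>s - 1\<close> triples on \<open>s\<close> vertices.
  The expected number of triples is of order \<open>c t^2/6\<close>, whereas for each \<open>s\<close> the expected number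
  of bad sets is at most a constant times \<open>t^s p^(s-1)\<close>, which is linear in \<open>t\<close>.  This is why \<open>s - 2\<close> is
  the right threshold: forbidding \<open>s - 2\<close> triples would cost of order \<open>t^2\<close>.
\<close>
lemma sparse_triple_system_exists:
  fixes C :: real and M :: nat
  assumes "0 \<le> C"
  shows "\<exists>t>0. \<exists>F \<subseteq> nsets {..<t} 3. C * real t ^ 2 \<le> real (card F) \<and>
      (\<forall>W\<subseteq>{..<t}. card W \<le> M \<longrightarrow> card {e\<in>F. e \<subseteq> W} \<le> card W - 2)"
proof -
  define c where "c = 6 * C + 6"
  define K where "K = (\<Sum>s\<in>{4..M}. 2 ^ (s choose 3) * c ^ (s - 1))"
  have c: "c \<ge> 6" using assms by (simp add: c_def)
  have K: "K \<ge> 0" unfolding K_def using c by (intro sum_nonneg) auto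
  \<comment> \<open>\<open>t \<ge> 3(C + 1) + K\<close> lets \<open>t^2\<close> absorb the linear terms of \<open>(C + 1)(t - 1)(t - 2) - K t\<close>; \<open>t \<ge> c\<close> makes \<open>p \<le> 1\<close>\<close>
  obtain t :: nat where t: "real t \<ge> c + 3 * (C + 1) + K + 3"
    using real_arch_simple by blast
  have "3 \<le> c + 3 * (C + 1) + K + 3" using c K assms by simp
  with t have "real t \<ge> 3" by (rule order_trans[rotated])
  then have t3: "real t \<ge> 3" "t \<ge> 3" by simp_all
  define p where "p = c / real t"
  have p: "0 \<le> p" "p \<le> 1" using c t t3 K assms by (auto simp: p_def divide_simps)
  define X where "X = nsets {..<t} 3"
  define I where "I = (SIGMA s:{4..M}. SIGMA W:nsets {..<t} s. {B. B \<subseteq> nsets W 3 \<and> card B = s - 1})"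
  have finX: "finite X" by (simp add: X_def finite_imp_finite_nsets)
  have finW: "finite W" if "W \<in> nsets {..<t} s" for W s
    using that by (auto simp: nsets_def)
  have finB: "finite {B. B \<subseteq> nsets W 3 \<and> card B = s - 1}" if "W \<in> nsets {..<t} s" for W s
    using finW[OF that] by (simp add: finite_imp_finite_nsets)
  have finI: "finite I" unfolding I_def
    using finB by (intro finite_SigmaI) (auto simp: finite_imp_finite_nsets)
  have "(\<Sum>i\<in>I. p ^ card (snd (snd i)))
      = (\<Sum>s\<in>{4..M}. \<Sum>W\<in>nsets {..<t} s. \<Sum>B\<in>{B. B \<subseteq> nsets W 3 \<and> card B = s - 1}. p ^ card B)"
    unfolding I_def using finB
    by (simp add: sum_over_Sigma finite_imp_finite_nsets)
  also have "\<dots> \<le> (\<Sum>s\<in>{4..M}. 2 ^ (s choose 3) * c ^ (s - 1) * real t)"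
  proof (rule sum_mono)
    fix s assume s: "s \<in> {4..M}"
    have inner: "(\<Sum>B\<in>{B. B \<subseteq> nsets W 3 \<and> card B = s - 1}. p ^ card B) \<le> 2 ^ (s choose 3) * p ^ (s - 1)"
      if W: "W \<in> nsets {..<t} s" for W
    proof -
      have "card {B. B \<subseteq> nsets W 3 \<and> card B = s - 1} \<le> card (Pow (nsets W 3))"
        using finW[OF W] by (intro card_mono) (auto simp: finite_imp_finite_nsets)
      also have "\<dots> = 2 ^ (s choose 3)"
        using W finW[OF W] 
        by (simp add: card_Pow finite_imp_finite_nsets) (simp add: nsets_def)
      finally have "real (card {B. B \<subseteq> nsets W 3 \<and> card B = s - 1}) \<le> 2 ^ (s choose 3)"
        by (metis of_nat_le_iff of_nat_numeral of_nat_power)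
      then show ?thesis using p by (simp add: mult_right_mono)
    qed
    have "(\<Sum>W\<in>nsets {..<t} s. \<Sum>B\<in>{B. B \<subseteq> nsets W 3 \<and> card B = s - 1}. p ^ card B)
        \<le> (\<Sum>W\<in>nsets {..<t} s. 2 ^ (s choose 3) * p ^ (s - 1))"
      using inner by (rule sum_mono)
    also have "\<dots> = real (t choose s) * (2 ^ (s choose 3) * p ^ (s - 1))"
      by simp
    also have "\<dots> \<le> real t ^ s * (2 ^ (s choose 3) * p ^ (s - 1))"
    proof -
      have "real (t choose s) \<le> real t ^ s"
      proof (cases "s \<le> t")
        case True
        then show ?thesis using binomial_le_pow[of s t] by (metis of_nat_le_iff of_nat_power)
      qed (simp add: binomial_eq_0)
      then show ?thesis using p by (intro mult_right_mono) auto
    qed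
    also have "real t ^ s = real t * real t ^ (s - 1)"
      using s by (cases s) auto
    also have "real t * real t ^ (s - 1) * (2 ^ (s choose 3) * p ^ (s - 1))
        = 2 ^ (s choose 3) * (real t * p) ^ (s - 1) * real t"
      by (simp add: power_mult_distrib)
    also have "real t * p = c" using t3 by (simp add: p_def)
    finally show "(\<Sum>W\<in>nsets {..<t} s. \<Sum>B\<in>{B. B \<subseteq> nsets W 3 \<and> card B = s - 1}. p ^ card B)
        \<le> 2 ^ (s choose 3) * c ^ (s - 1) * real t" .
  qed
  also have "\<dots> = K * real t" by (simp add: K_def sum_distrib_right)
  finally have loss: "(\<Sum>i\<in>I. p ^ card (snd (snd i))) \<le> K * real t" .
  have "snd (snd i) \<noteq> {}" if "i \<in> I" for i
    using that by (auto simp: I_def)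
  then obtain F where F: "F \<subseteq> X" "\<forall>i\<in>I. \<not> snd (snd i) \<subseteq> F"
    and card_F: "p * real (card X) - (\<Sum>i\<in>I. p ^ card (snd (snd i))) \<le> real (card F)"
    using deletion_method[of X I p "\<lambda>i. snd (snd i)"] finX finI p by blast
  have "real (card X) = real t * (real t - 1) * (real t - 2) / 6"
  proof -
    have "real (t choose 3) = (\<Prod>i = 0..<3. real t - real i) / 6"
      using binomial_gbinomial[of t 3, where 'a = real] by (simp add: gbinomial_prod_rev fact_numeral)
    then show ?thesis by (simp add: X_def numeral_3_eq_3 field_simps)
  qed
  moreover have "p * (real t * (real t - 1) * (real t - 2) / 6) = (C + 1) * ((real t - 1) * (real t - 2))"
  proof -
    have "p * (real t * (real t - 1) * (real t - 2) / 6) = c / 6 * ((real t - 1) * (real t - 2))"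
      using t3 by (simp add: p_def)
    also have "c / 6 = C + 1" by (simp add: c_def)
    finally show ?thesis .
  qed
  ultimately have "p * real (card X) = (C + 1) * ((real t - 1) * (real t - 2))" by (simp only:)
  moreover have "(C + 1) * ((real t - 1) * (real t - 2)) - K * real t \<ge> C * real t ^ 2"
  proof -
    have "(C + 1) * ((real t - 1) * (real t - 2)) - K * real t - C * real t ^ 2
        = real t * (real t - 3 * (C + 1) - K) + 2 * (C + 1)"
      by (simp add: algebra_simps power2_eq_square)
    moreover have "real t * (real t - 3 * (C + 1) - K) \<ge> 0"
      using t c by (intro mult_nonneg_nonneg) auto
    ultimately have "0 \<le> (C + 1) * ((real t - 1) * (real t - 2)) - K * real t - C * real t ^ 2"
      using assms by simp
    then show ?thesis by (simp only: diff_ge_0_iff_ge)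
  qed
  ultimately have many: "C * real t ^ 2 \<le> real (card F)"
    using card_F loss by linarith
  have "card {e\<in>F. e \<subseteq> W} \<le> card W - 2" if W: "W \<subseteq> {..<t}" "card W \<le> M" for W
  proof (rule ccontr)
    assume neg: "\<not> ?thesis"
    have fW: "finite W" using W finite_subset by blast
    have sub: "{e\<in>F. e \<subseteq> W} \<subseteq> nsets W 3" using F by (auto simp: X_def nsets_def)
    have "card {e\<in>F. e \<subseteq> W} \<le> card W choose 3"
      using card_mono[OF finite_imp_finite_nsets[OF fW] sub] by simp
    moreover have "card W choose 3 \<le> card W - 2" if "card W \<le> 3"
    proof (cases "card W = 3")
      case False
      then have "card W < 3" using that by auto
      then show ?thesis by (simp add: binomial_eq_0)
    qed simp
    ultimately have W4: "card W \<ge> 4" using neg by linarith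
    from neg have "card W - 1 \<le> card {e\<in>F. e \<subseteq> W}" by linarith
    then obtain B where B: "B \<subseteq> {e\<in>F. e \<subseteq> W}" "card B = card W - 1"
      by (meson obtain_subset_with_card_n)
    then have "(card W, W, B) \<in> I"
      using W W4 fW sub by (auto simp: I_def nsets_def)
    with F(2) have "\<not> B \<subseteq> F" by fastforce
    then show False using B(1) by auto
  qed
  then show ?thesis using many F(1) t3 by (intro exI[of _ t]) (auto simp: X_def)
qed

section \<open>Edge sums of locally sparse triple systems\<close>

text \<open>
  Think of \<open>f e\<close> as the smallest weight in \<open>e\<close>.  The claim is summation by parts over the level sets
  of \<open>u\<close>: the set of vertices of weight at least \<open>\<theta>\<close> spans at most as many edges as it has vertices
  other than \<open>a\<close> and \<open>b\<close>.  The level \<open>\<theta>\<close> is a parameter so that the induction, which deletes a lightest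
  vertex, can raise it to the weight of that vertex; all edges through that vertex then
  contribute at most zero.
\<close>
lemma heaviest_two_bound_truncated:
  fixes u :: "'a \<Rightarrow> real" and f :: "'a set \<Rightarrow> real"
  assumes "finite W" "a \<in> W" "b \<in> W" "a \<noteq> b" "finite F"
    and "\<And>W'. W' \<subseteq> W \<Longrightarrow> card {e\<in>F. e \<subseteq> W'} \<le> card W' - 2"
    and "\<And>v. v \<in> W \<Longrightarrow> u v \<le> u a \<and> u v \<le> u b \<or> v = a \<or> v = b"
    and "\<And>e v. e \<in> F \<Longrightarrow> v \<in> e \<Longrightarrow> f e \<le> u v"
    and "\<And>v. v \<in> W \<Longrightarrow> \<theta> \<le> u v"
  shows "(\<Sum>e\<in>{e\<in>F. e \<subseteq> W}. f e - \<theta>) \<le> (\<Sum>v\<in>W - {a, b}. u v - \<theta>)"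
  using assms
proof (induction "card W" arbitrary: W \<theta> rule: less_induct)
  case less
  show ?case
  proof (cases "W = {a, b}")
    case True
    then have "card {e\<in>F. e \<subseteq> W} = 0"
      using less.prems(6)[of W] \<open>a \<noteq> b\<close> by simp
    then have "{e\<in>F. e \<subseteq> W} = {}" 
      using finite_subset[OF _ less.prems(5)] by (metis (no_types, lifting) card_eq_0_iff mem_Collect_eq subsetI)
    then show ?thesis using True by (simp only: sum.empty) simp
  next
    case False
    then have ne: "W - {a, b} \<noteq> {}" using less.prems by auto
    define v where "v = arg_min_on u (W - {a, b})"
    have v: "v \<in> W" "v \<noteq> a" "v \<noteq> b"
      using arg_min_if_finite(1)[of "W - {a, b}" u] ne less.prems(1) unfolding v_def by auto
    have "u v \<le> u z" if "z \<in> W - {a, b}" for z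
      using arg_min_least[of "W - {a, b}" z u] ne less.prems(1) that unfolding v_def by auto
    then have vmin: "u v \<le> u z" if "z \<in> W" for z
      using less.prems(7)[OF v(1)] v that by auto
    define W0 where "W0 = W - {v}"
    define n where "n = real (card {e\<in>F. e \<subseteq> W})"
    have IH: "(\<Sum>e\<in>{e\<in>F. e \<subseteq> W0}. f e - u v) \<le> (\<Sum>z\<in>W0 - {a, b}. u z - u v)"
    proof (rule less.hyps)
      show "card W0 < card W"
        using v less.prems(1) unfolding W0_def by (intro psubset_card_mono) auto
      show "finite W0" "a \<in> W0" "b \<in> W0" "a \<noteq> b" "finite F"
        using less.prems(1-5) v by (auto simp: W0_def)
      show "card {e\<in>F. e \<subseteq> W'} \<le> card W' - 2" if "W' \<subseteq> W0" for W'
        using less.prems(6)[of W'] that by (auto simp: W0_def)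
      show "u z \<le> u a \<and> u z \<le> u b \<or> z = a \<or> z = b" if "z \<in> W0" for z
        using less.prems(7)[of z] that by (auto simp: W0_def)
      show "f e \<le> u z" if "e \<in> F" "z \<in> e" for e z
        using less.prems(8) that by blast
      show "u v \<le> u z" if "z \<in> W0" for z
        using vmin that by (auto simp: W0_def)
    qed
    have split: "(\<Sum>e\<in>{e\<in>F. e \<subseteq> W}. f e - \<theta>)
        = (\<Sum>e\<in>{e\<in>F. e \<subseteq> W}. f e - u v) + n * (u v - \<theta>)"
      by (simp add: sum_subtractf n_def algebra_simps)
    have drop: "(\<Sum>e\<in>{e\<in>F. e \<subseteq> W}. f e - u v) \<le> (\<Sum>e\<in>{e\<in>F. e \<subseteq> W0}. f e - u v)"
    proof -
      have "(\<Sum>e\<in>{e\<in>F. e \<subseteq> W0}. u v - f e) \<le> (\<Sum>e\<in>{e\<in>F. e \<subseteq> W}. u v - f e)"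
        using less.prems(5,8) v(1) by (intro sum_mono2) (auto simp: W0_def)
      then show ?thesis by (simp add: sum_subtractf)
    qed
    have card: "card (W - {a, b}) = card W - 2" "card W \<ge> 2"
      using less.prems(1-4) card_mono[of W "{a, b}"] by (auto simp: card_Diff_subset)
    have "n * (u v - \<theta>) \<le> (real (card W) - 2) * (u v - \<theta>)"
    proof (rule mult_right_mono)
      have "card {e\<in>F. e \<subseteq> W} + 2 \<le> card W"
        using less.prems(6)[OF subset_refl] card(2) by linarith
      then show "n \<le> real (card W) - 2" unfolding n_def by linarith
    qed (use less.prems(9)[OF v(1)] in simp)
    moreover have "(\<Sum>z\<in>W0 - {a, b}. u z - u v) = (\<Sum>z\<in>W - {a, b}. u z - u v)"
      using less.prems(1) v unfolding W0_def by (intro sum.mono_neutral_left) auto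
    moreover have "(\<Sum>z\<in>W - {a, b}. u z - u v) + (real (card W) - 2) * (u v - \<theta>)
        = (\<Sum>z\<in>W - {a, b}. u z - \<theta>)"
      using card by (simp add: sum_subtractf of_nat_diff algebra_simps)
    ultimately show ?thesis using split drop IH by linarith
  qed
qed

text \<open>
  In each edge the two heavier vertices have a product of at most \<open>u a * u b\<close>, which reduces the claim to
  a bound on the sum of the smallest weights of the edges.
\<close>
lemma heaviest_two_bound:
  fixes u :: "'a \<Rightarrow> real"
  assumes W: "finite W" "a \<in> W" "b \<in> W" "a \<noteq> b" and F: "F \<subseteq> nsets W 3"
    and sparse: "\<And>W'. W' \<subseteq> W \<Longrightarrow> card {e\<in>F. e \<subseteq> W'} \<le> card W' - 2"
    and top: "\<And>v. v \<in> W \<Longrightarrow> v \<noteq> a \<Longrightarrow> v \<noteq> b \<Longrightarrow> u v \<le> u a \<and> u v \<le> u b"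
    and nonneg: "\<And>v. v \<in> W \<Longrightarrow> 0 \<le> u v"
  shows "lagrangian F u \<le> u a * u b * (sum u W - u a - u b)"
proof -
  have finF: "finite F" using F W finite_subset finite_imp_finite_nsets by blast
  have edge: "(\<Prod>v\<in>e. u v) \<le> u a * u b * Min (u ` e)" if "e \<in> F" for e
  proof -
    from that F have e: "e \<subseteq> W" "card e = 3" "finite e" by (auto simp: nsets_def)
    then have "e \<noteq> {}" by auto
    then have "Min (u ` e) \<in> u ` e" using e by (intro Min_in) auto
    then obtain r where r: "r \<in> e" "Min (u ` e) = u r" by blast
    then have "card (e - {r}) = 2" using e by simp
    then obtain p q where pq: "e - {r} = {p, q}" "p \<noteq> q" by (auto simp: card_2_iff)
    then have "p \<in> W" "q \<in> W" using e by auto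
    have "u p * u q \<le> u a * u b"
    proof (cases "p = b \<or> q = a")
      case True
      then have "u p * u q = u q * u p \<and> u q \<le> u a \<and> u p \<le> u b"
        using top[OF \<open>p \<in> W\<close>] top[OF \<open>q \<in> W\<close>] pq(2) by (cases "q = a"; cases "p = b") auto
      then show ?thesis
        using nonneg \<open>p \<in> W\<close> \<open>q \<in> W\<close> W mult_mono[of "u q" "u a" "u p" "u b"]
        by (simp add: mult.commute)
    next
      case False
      then have "u p \<le> u a" "u q \<le> u b"
        using top[OF \<open>p \<in> W\<close>] top[OF \<open>q \<in> W\<close>] by (cases "p = a"; cases "q = b"; auto)+
      then show ?thesis
        using nonneg \<open>p \<in> W\<close> \<open>q \<in> W\<close> W by (intro mult_mono) auto
    qed
    moreover have "(\<Prod>v\<in>e. u v) = u r * (u p * u q)"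
      using prod.remove[of e r u] e r pq by simp
    ultimately show ?thesis
      using r nonneg[of r] e mult_right_mono[of "u p * u q" "u a * u b" "u r"]
      by (auto simp: mult.commute)
  qed
  have all: "{e\<in>F. e \<subseteq> W} = F" using F by (auto simp: nsets_def)
  have "(\<Sum>e\<in>{e\<in>F. e \<subseteq> W}. Min (u ` e) - 0) \<le> (\<Sum>v\<in>W - {a, b}. u v - 0)"
  proof (rule heaviest_two_bound_truncated)
    fix e v assume "e \<in> F" "v \<in> e"
    then show "Min (u ` e) \<le> u v" using F by (auto simp: nsets_def)
  next
    show "card {e\<in>F. e \<subseteq> W'} \<le> card W' - 2" if "W' \<subseteq> W" for W'
      using sparse that .
    show "u v \<le> u a \<and> u v \<le> u b \<or> v = a \<or> v = b" if "v \<in> W" for v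
      using top that by blast
  qed (use W finF nonneg in auto)
  also have "(\<Sum>v\<in>W - {a, b}. u v - 0) = sum u W - u a - u b"
    using W by (simp add: sum_diff)
  finally have "(\<Sum>e\<in>F. Min (u ` e)) \<le> sum u W - u a - u b"
    unfolding all by simp
  then have "u a * u b * (\<Sum>e\<in>F. Min (u ` e)) \<le> u a * u b * (sum u W - u a - u b)"
    using nonneg W by (intro mult_left_mono) auto
  moreover have "lagrangian F u \<le> u a * u b * (\<Sum>e\<in>F. Min (u ` e))"
    unfolding lagrangian_def sum_distrib_left using edge by (rule sum_mono)
  ultimately show ?thesis by linarith
qed

text \<open>
  The bound on the net effect of a locally sparse system \<open>F\<close> on one part of a pattern, when
  all pairs inside that part form edges with all of the weight \<open>x\<close> outside: the square term is the
  loss from splitting the part into single vertices.  With \<open>a\<close> and \<open>b\<close> the heaviest vertices and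
  \<open>s = u a + u b\<close>, it follows from \<open>u a * u b \<le> s^2/4\<close> and \<open>u a^2 + u b^2 \<ge> s^2/2\<close>.
\<close>
lemma sparse_lagrangian_bound:
  fixes u :: "'a \<Rightarrow> real"
  assumes W: "finite W" and F: "F \<subseteq> nsets W 3"
    and sparse: "\<And>W'. W' \<subseteq> W \<Longrightarrow> card {e\<in>F. e \<subseteq> W'} \<le> card W' - 2"
    and nonneg: "\<And>v. v \<in> W \<Longrightarrow> 0 \<le> u v" and x: "0 \<le> x"
  obtains s where "0 \<le> s" 
    "6 * lagrangian F u - 3 * x * (\<Sum>v\<in>W. u v ^ 2) \<le> 3/2 * s ^ 2 * (sum u W - x - s)"
proof (cases "card W \<ge> 2")
  case False
  have "card F \<le> card W - 2"
  proof -
    have "{e\<in>F. e \<subseteq> W} = F" using F by (auto simp: nsets_def)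
    then show ?thesis using sparse[of W] by simp
  qed
  moreover have "finite F" using F W finite_subset finite_imp_finite_nsets by blast
  ultimately have "F = {}" using False by simp
  moreover have "0 \<le> x * (\<Sum>v\<in>W. u v ^ 2)" using x by (simp add: sum_nonneg)
  ultimately show ?thesis using that[of 0] by (simp add: lagrangian_def)
next
  case True
  then have "W \<noteq> {}" by auto
  have heaviest: "\<exists>a\<in>S. \<forall>v\<in>S. u v \<le> u a" if "finite S" "S \<noteq> {}" for S
  proof -
    have "Max (u ` S) \<in> u ` S" using that by (intro Max_in) auto
    then obtain a where "a \<in> S" "Max (u ` S) = u a" by blast
    then show ?thesis using that Max_ge[of "u ` S"] by auto
  qed
  obtain a where a: "a \<in> W" "\<And>v. v \<in> W \<Longrightarrow> u v \<le> u a"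
    using heaviest[OF W \<open>W \<noteq> {}\<close>] by blast
  have "card (W - {a}) > 0" using True a W by simp
  then have "W - {a} \<noteq> {}" by force
  then obtain b where b: "b \<in> W - {a}" "\<And>v. v \<in> W - {a} \<Longrightarrow> u v \<le> u b"
    using heaviest[of "W - {a}"] W by blast
  have L: "lagrangian F u \<le> u a * u b * (sum u W - u a - u b)"
    by (rule heaviest_two_bound[OF W _ _ _ F sparse]) (use a b nonneg in auto)
  have q: "(\<Sum>v\<in>W. u v ^ 2) \<ge> u a ^ 2 + u b ^ 2"
    using sum_mono2[of W "{a, b}" "\<lambda>v. u v ^ 2"] W a b by auto
  have rest: "sum u W - u a - u b \<ge> 0"
    using sum_mono2[of W "{a, b}" u] W a b nonneg by auto
  define s where "s = u a + u b"
  have "u a * u b \<le> s ^ 2 / 4" "u a ^ 2 + u b ^ 2 \<ge> s ^ 2 / 2"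
    using sum_squares_bound[of "u a" "u b"] by (simp_all add: s_def power2_sum)
  then have "u a * u b * (sum u W - u a - u b) \<le> s ^ 2 / 4 * (sum u W - u a - u b)"
    "x * (\<Sum>v\<in>W. u v ^ 2) \<ge> x * (s ^ 2 / 2)"
    using rest q x by (intro mult_right_mono mult_left_mono; linarith)+
  then have "6 * lagrangian F u - 3 * x * (\<Sum>v\<in>W. u v ^ 2)
      \<le> 6 * (s ^ 2 / 4 * (sum u W - u a - u b)) - 3 * (x * (s ^ 2 / 2))"
    using L by linarith
  also have "\<dots> = 3/2 * s ^ 2 * (sum u W - x - s)"
    by (simp add: s_def field_simps)
  finally show ?thesis
    using that[of s] a b nonneg by (auto simp: s_def)
qed

section \<open>Complete triple systems\<close>

lemma nsets_insert:
  assumes "x \<notin> S"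
  shows "nsets (insert x S) (Suc j) = nsets S (Suc j) \<union> insert x ` nsets S j"
proof (intro equalityI subsetI)
  fix e assume e: "e \<in> nsets (insert x S) (Suc j)"
  show "e \<in> nsets S (Suc j) \<union> insert x ` nsets S j"
  proof (cases "x \<in> e")
    case True
    then have "e = insert x (e - {x})" "e - {x} \<in> nsets S j" using e by (auto simp: nsets_def)
    then show ?thesis by blast
  qed (use e in \<open>auto simp: nsets_def\<close>)
next
  fix e assume "e \<in> nsets S (Suc j) \<union> insert x ` nsets S j"
  moreover have "x \<notin> d" if "d \<in> nsets S j" for d using that assms by (auto simp: nsets_def)
  ultimately show "e \<in> nsets (insert x S) (Suc j)" by (auto simp: nsets_def)
qed

lemma lagrangian_complete_insert:
  assumes "finite S" "x \<notin> S"
  shows "lagrangian (nsets (insert x S) (Suc j)) w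
    = lagrangian (nsets S (Suc j)) w + w x * lagrangian (nsets S j) w"
proof -
  have nx: "x \<notin> e" "finite e" if "e \<in> nsets S i" for e i using that assms by (auto simp: nsets_def)
  have inj: "inj_on (insert x) (nsets S j)"
    using nx(1) by (intro inj_onI) (metis Diff_insert_absorb)
  have "lagrangian (nsets (insert x S) (Suc j)) w
      = lagrangian (nsets S (Suc j)) w + (\<Sum>e\<in>insert x ` nsets S j. \<Prod>v\<in>e. w v)"
    unfolding lagrangian_def nsets_insert[OF assms(2)]
    using assms(1) nx by (intro sum.union_disjoint) (auto simp: finite_imp_finite_nsets)
  also have "(\<Sum>e\<in>insert x ` nsets S j. \<Prod>v\<in>e. w v) = w x * lagrangian (nsets S j) w"
    unfolding lagrangian_def sum_distrib_left using nx by (simp add: sum.reindex[OF inj])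
  finally show ?thesis .
qed

text \<open>
  Newton's identity for the third elementary symmetric polynomial.
\<close>
lemma lagrangian_complete_3:
  assumes "finite S"
  shows "6 * lagrangian (nsets S 3) w
    = (sum w S) ^ 3 - 3 * sum w S * (\<Sum>v\<in>S. w v ^ 2) + 2 * (\<Sum>v\<in>S. w v ^ 3)"
proof -
  have one: "lagrangian (nsets S 1) w = sum w S" if "finite S" for S
    using that
  proof (induction S rule: finite_induct)
    case (insert x S)
    then show ?case using lagrangian_complete_insert[of S x 0 w] by (simp add: lagrangian_def)
  qed (simp add: lagrangian_def nsets_empty_iff)
  have two: "2 * lagrangian (nsets S 2) w = (sum w S) ^ 2 - (\<Sum>v\<in>S. w v ^ 2)" if "finite S" for S
    using that
  proof (induction S rule: finite_induct)
    case (insert x S)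
    then show ?case using lagrangian_complete_insert[of S x 1 w] one[of S]
      by (simp add: numeral_2_eq_2 algebra_simps)
  qed (simp add: lagrangian_def nsets_empty_iff)
  show ?thesis using assms
  proof (induction S rule: finite_induct)
    case (insert x S)
    have "6 * lagrangian (nsets (insert x S) 3) w
        = 6 * lagrangian (nsets S 3) w + 3 * w x * (2 * lagrangian (nsets S 2) w)"
      using lagrangian_complete_insert[of S x 2 w] insert by (simp add: numeral_3_eq_3 numeral_2_eq_2)
    also have "\<dots> = (sum w (insert x S)) ^ 3 - 3 * sum w (insert x S) * (\<Sum>v\<in>insert x S. w v ^ 2)
        + 2 * (\<Sum>v\<in>insert x S. w v ^ 3)"
      unfolding insert.IH two[OF insert.hyps(1)] using insert.hyps
      by (simp add: power2_eq_square power3_eq_cube algebra_simps)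
    finally show ?case .
  qed (simp add: lagrangian_def nsets_empty_iff)
qed

text \<open>
  Among weights of given sum on \<open>A\<close>, equal weights minimise the sum of squares and maximise the edge
  sum of the complete triple system.  The second part, a Maclaurin inequality, follows from
  the Cauchy-Schwarz inequality on the sets \<open>A - {v}\<close>, weighted by \<open>w v\<close> and added up over \<open>v\<close>.
\<close>
lemma power_sums_maclaurin:
  fixes w :: "'a \<Rightarrow> real"
  assumes A: "finite A" "2 \<le> card A" and nonneg: "\<And>v. v \<in> A \<Longrightarrow> 0 \<le> w v"
  defines "b \<equiv> 1 / real (card A)"
  shows "b * sum w A ^ 2 \<le> (\<Sum>v\<in>A. w v ^ 2)"
    and "sum w A ^ 3 - 3 * sum w A * (\<Sum>v\<in>A. w v ^ 2) + 2 * (\<Sum>v\<in>A. w v ^ 3)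
      \<le> (1 - b) * (1 - 2 * b) * sum w A ^ 3"
proof -
  define m p1 p2 p3 where "m = real (card A)" and "p1 = sum w A"
    and "p2 = (\<Sum>v\<in>A. w v ^ 2)" and "p3 = (\<Sum>v\<in>A. w v ^ 3)"
  have m: "m \<ge> 2" "b = 1 / m" using A by (auto simp: m_def b_def)
  have cs: "(sum w S) ^ 2 \<le> real (card S) * (\<Sum>v\<in>S. w v ^ 2)" if "S \<subseteq> A" for S
    using sum_squared_le_sum_of_squares[of w S] by (simp add: mult.commute)
  have p2: "p1 ^ 2 \<le> m * p2" using cs[of A] by (simp add: m_def p1_def p2_def)
  have p1: "p1 \<ge> 0" using nonneg by (simp add: p1_def sum_nonneg)
  have bp2: "b * p1 ^ 2 \<le> p2"
    using p2 m(1) unfolding m(2) by (simp add: pos_divide_le_eq mult.commute)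
  then show "b * sum w A ^ 2 \<le> (\<Sum>v\<in>A. w v ^ 2)" by (simp add: p1_def p2_def)
  have "w v * (p1 - w v) ^ 2 \<le> w v * ((m - 1) * (p2 - w v ^ 2))" if "v \<in> A" for v
  proof (rule mult_left_mono)
    show "(p1 - w v) ^ 2 \<le> (m - 1) * (p2 - w v ^ 2)"
      using cs[of "A - {v}"] A that
      by (simp add: m_def p1_def p2_def sum_diff1 of_nat_diff)
  qed (rule nonneg[OF that])
  then have "(\<Sum>v\<in>A. w v * (p1 - w v) ^ 2) \<le> (\<Sum>v\<in>A. w v * ((m - 1) * (p2 - w v ^ 2)))"
    by (rule sum_mono)
  also have "(\<Sum>v\<in>A. w v * (p1 - w v) ^ 2) = (\<Sum>v\<in>A. p1 ^ 2 * w v - 2 * p1 * w v ^ 2 + w v ^ 3)"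
    by (intro sum.cong refl) (simp add: power2_eq_square power3_eq_cube algebra_simps)
  also have "\<dots> = p1 ^ 2 * p1 - 2 * p1 * p2 + p3"
    unfolding p1_def p2_def p3_def by (simp add: sum.distrib sum_subtractf sum_distrib_left)
  also have "(\<Sum>v\<in>A. w v * ((m - 1) * (p2 - w v ^ 2))) = (m - 1) * (\<Sum>v\<in>A. p2 * w v - w v ^ 3)"
    unfolding sum_distrib_left
    by (intro sum.cong refl) (simp add: power2_eq_square power3_eq_cube algebra_simps)
  also have "(\<Sum>v\<in>A. p2 * w v - w v ^ 3) = p2 * p1 - p3"
    unfolding p1_def p3_def by (simp add: sum_subtractf sum_distrib_left)
  finally have star: "p1 ^ 2 * p1 - 2 * p1 * p2 + p3 \<le> (m - 1) * (p2 * p1 - p3)" .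
  define Y where "Y = p1 ^ 3 - 3 * p1 * p2 + 2 * p3"
  have "m * Y \<le> (m - 2) * (p1 ^ 3 - p1 * p2)"
    using star by (simp add: Y_def power2_eq_square power3_eq_cube algebra_simps)
  also have "\<dots> \<le> (m - 2) * (p1 ^ 3 - p1 * (b * p1 ^ 2))"
    using m(1) bp2 p1 by (intro mult_left_mono diff_left_mono) auto
  also have "\<dots> = m * ((1 - b) * (1 - 2 * b) * p1 ^ 3)"
  proof -
    have "m - 2 = m * (1 - 2 * b)" using m by (simp add: algebra_simps)
    then have "(m - 2) * (p1 ^ 3 - p1 * (b * p1 ^ 2)) = m * (1 - 2 * b) * (p1 ^ 3 - p1 * (b * p1 ^ 2))"
      by (simp only:)
    then show ?thesis by (simp add: power2_eq_square power3_eq_cube algebra_simps)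
  qed
  finally have "Y \<le> (1 - b) * (1 - 2 * b) * p1 ^ 3" using m by simp
  then show "sum w A ^ 3 - 3 * sum w A * (\<Sum>v\<in>A. w v ^ 2) + 2 * (\<Sum>v\<in>A. w v ^ 3)
      \<le> (1 - b) * (1 - 2 * b) * sum w A ^ 3"
    by (simp add: Y_def p1_def p2_def p3_def)
qed

text \<open>
  The vertices of \<open>A\<close> are the \<open>m\<close> parts of the pattern, each contracted to one vertex, and \<open>B\<close> is the part that
  has been split into single vertices.
\<close>
definition complete_except :: "'a set \<Rightarrow> 'a set \<Rightarrow> 'a set set \<Rightarrow> 'a set set" where
  "complete_except A B F = (nsets (A \<union> B) 3 - nsets B 3) \<union> F"

lemma lagrangian_complete_except:
  assumes "finite A" "finite B" "A \<inter> B = {}" "F \<subseteq> nsets B 3"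
  shows "6 * lagrangian (complete_except A B F) w
    = (sum w A ^ 3 - 3 * sum w A * (\<Sum>v\<in>A. w v ^ 2) + 2 * (\<Sum>v\<in>A. w v ^ 3))
      + 3 * (sum w A ^ 2 - (\<Sum>v\<in>A. w v ^ 2)) * sum w B
      + 3 * sum w A * (sum w B ^ 2 - (\<Sum>v\<in>B. w v ^ 2)) + 6 * lagrangian F w"
proof -
  have fin: "finite (nsets (A \<union> B) 3)" "finite (nsets B 3)" "finite F"
    using assms by (auto simp: finite_imp_finite_nsets intro: finite_subset)
  have "lagrangian (complete_except A B F) w
      = lagrangian (nsets (A \<union> B) 3 - nsets B 3) w + lagrangian F w"
    unfolding lagrangian_def complete_except_def using fin assms(4) by (intro sum.union_disjoint) auto
  also have "lagrangian (nsets (A \<union> B) 3 - nsets B 3) w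
      = lagrangian (nsets (A \<union> B) 3) w - lagrangian (nsets B 3) w"
    unfolding lagrangian_def using fin by (intro sum_diff nsets_mono) auto
  finally have "6 * lagrangian (complete_except A B F) w
      = 6 * lagrangian (nsets (A \<union> B) 3) w - 6 * lagrangian (nsets B 3) w + 6 * lagrangian F w"
    by simp
  then show ?thesis
    using assms by (simp add: lagrangian_complete_3 sum.union_disjoint)
      (simp add: power2_eq_square power3_eq_cube algebra_simps)
qed

section \<open>The cubic\<close>

text \<open>
  The density of the pattern with relative weight \<open>x\<close> on \<open>1/b\<close> equal parts and \<open>1 - x\<close> on the
  remaining part, see \<open>cubic_eq\<close>.
\<close>
definition cubic :: "real \<Rightarrow> real \<Rightarrow> real" where
  "cubic b x = (1 + 2 * b ^ 2) * x ^ 3 - 3 * (1 + b) * x ^ 2 + 3 * x"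

text \<open>
  The smaller root of the derivative of \<open>cubic b\<close>.
\<close>
definition peak :: "real \<Rightarrow> real" where
  "peak b = (1 + b - sqrt (2 * b - b ^ 2)) / (1 + 2 * b ^ 2)"

lemma cubic_eq:
  "cubic b x = (1 - b) * (1 - 2 * b) * x ^ 3 + 3 * (1 - b) * x ^ 2 * (1 - x) + 3 * x * (1 - x) ^ 2"
  by (simp add: cubic_def power2_eq_square power3_eq_cube algebra_simps)

text \<open>
  The peak is a double root of the difference; the linear factor is determined by the
  sum of the three roots.
\<close>
lemma cubic_peak_minus:
  assumes "0 \<le> b" "b \<le> 2"
  shows "cubic b (peak b) - cubic b x
    = (x - peak b) ^ 2 * (1 + b + 2 * sqrt (2 * b - b ^ 2) - (1 + 2 * b ^ 2) * x)"
proof -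
  define c u D x0 where "c = 1 + 2 * b ^ 2" and "u = 1 + b" and "D = sqrt (2 * b - b ^ 2)" and "x0 = peak b"
  have c: "c > 0" by (simp add: c_def add_pos_nonneg)
  have "0 \<le> b * (2 - b)" using assms by simp
  then have D2: "D ^ 2 = 2 * b - b ^ 2" by (simp add: D_def power2_eq_square algebra_simps)
  have co: "c * x0 = u - D" using c by (simp add: x0_def peak_def c_def u_def D_def)
  have "c * (c * x0 ^ 2 - 2 * u * x0 + 1) = (c * x0) ^ 2 - 2 * u * (c * x0) + c"
    by (simp add: power2_eq_square algebra_simps)
  also have "\<dots> = D ^ 2 - u ^ 2 + c" unfolding co by (simp add: power2_eq_square algebra_simps)
  also have "\<dots> = 0" unfolding D2 c_def u_def by (simp add: power2_eq_square algebra_simps)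
  finally have root: "c * x0 ^ 2 - 2 * u * x0 + 1 = 0" using c by simp
  have "u + 2 * D - c * x = 3 * u - 2 * (c * x0) - c * x" unfolding co by simp
  then have "(x - x0) ^ 2 * (u + 2 * D - c * x) = (x - x0) ^ 2 * (3 * u - 2 * (c * x0) - c * x)" by simp
  also have "\<dots> = (c * x0 ^ 3 - 3 * u * x0 ^ 2 + 3 * x0) - (c * x ^ 3 - 3 * u * x ^ 2 + 3 * x)
      + 3 * (x - x0) * (c * x0 ^ 2 - 2 * u * x0 + 1)"
    by (simp add: power2_eq_square power3_eq_cube algebra_simps)
  finally show ?thesis unfolding root by (simp add: cubic_def c_def u_def D_def x0_def)
qed

lemma cubic_le_peak:
  assumes "0 \<le> b" "b \<le> 1/2" "x \<le> 1"
  shows "cubic b x \<le> cubic b (peak b)"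
proof -
  have "(1 + 2 * b ^ 2) * x \<le> (1 + 2 * b ^ 2) * 1"
    using assms by (intro mult_left_mono) auto
  moreover have "2 * b ^ 2 \<le> b" 
    using mult_left_mono[of b "1/2" b] assms by (simp add: power2_eq_square)
  moreover have "0 \<le> b * (2 - b)" using assms by simp
  then have "0 \<le> sqrt (2 * b - b ^ 2)" by (simp add: power2_eq_square algebra_simps)
  ultimately have "(1 + 2 * b ^ 2) * x \<le> 1 + b + 2 * sqrt (2 * b - b ^ 2)"
    by argo
  then have "0 \<le> 1 + b + 2 * sqrt (2 * b - b ^ 2) - (1 + 2 * b ^ 2) * x"
    by (simp only: diff_ge_0_iff_ge)
  then have "0 \<le> cubic b (peak b) - cubic b x"
    using assms by (subst cubic_peak_minus) auto
  then show ?thesis by simp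
qed

lemma peak_bounds:
  assumes "0 < b" "b \<le> 1/2"
  shows "0 < peak b" "peak b < 1"
proof -
  have b2: "2 * b ^ 2 \<le> b"
    using mult_left_mono[of b "1/2" b] assms by (simp add: power2_eq_square)
  have "2 * b - b ^ 2 = 1 - (1 - b) ^ 2" by (simp add: power2_eq_square algebra_simps)
  then have "sqrt (2 * b - b ^ 2) \<le> 1" by simp
  then have "sqrt (2 * b - b ^ 2) < 1 + b" using assms(1) by linarith
  then show "0 < peak b"
    unfolding peak_def by (intro divide_pos_pos) (auto simp: add_pos_nonneg)
  have "b < sqrt (2 * b - b ^ 2)"
    using assms b2 by (intro real_less_rsqrt) simp
  then have "1 + b - sqrt (2 * b - b ^ 2) < 1" by simp
  also have "1 \<le> 1 + 2 * b ^ 2" by simp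
  finally show "peak b < 1"
    unfolding peak_def by (simp add: divide_less_eq_1 add_pos_nonneg)
qed

lemma cubic_less_1:
  assumes "0 < b" "b \<le> 1" "0 \<le> x" "x \<le> 1"
  shows "cubic b x < 1"
proof -
  have "1 - cubic b x = (1 - x) ^ 3 + b * x ^ 2 * (3 - 2 * b * x)"
    by (simp add: cubic_def power2_eq_square power3_eq_cube algebra_simps)
  moreover have "b * x \<le> 1" using assms mult_mono[of b 1 x 1] by simp
  then have "0 < (1 - x) ^ 3 + b * x ^ 2 * (3 - 2 * b * x)"
    using assms by (cases "x = 0") (auto intro!: add_nonneg_pos mult_pos_pos)
  ultimately show ?thesis by linarith
qed

text \<open>
  For \<open>x < 1/2\<close> and \<open>d = 1 - 2x\<close>, the perturbation is largest at \<open>s = 2d/3\<close>, where its value is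
  \<open>(2/9) d^3\<close>.  Expanding the cubic at \<open>1/2\<close> in powers of \<open>d\<close> shows that it falls short
  of its value at \<open>1/2\<close> by at least that much.  The coefficient of \<open>d\<close> in that expansion is where
  \<open>b \<le> 1/4\<close> enters.
\<close>
lemma cubic_perturbed_le_peak:
  assumes b: "0 \<le> b" "b \<le> 1/4" and x: "0 \<le> x" "x \<le> 1" and s: "0 \<le> s"
  shows "cubic b x + 3/2 * s ^ 2 * ((1 - x) - x - s) \<le> cubic b (peak b)"
proof (cases "x \<ge> 1/2")
  case True
  then have "3/2 * s ^ 2 * ((1 - x) - x - s) \<le> 0"
    using s by (intro mult_nonneg_nonpos) auto
  then show ?thesis using cubic_le_peak[of b x] b x by linarith
next
  case False
  define d where "d = 1 - 2 * x"
  have d: "0 \<le> d" "d \<le> 1" using False x by (auto simp: d_def)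
  have "2/9 * d ^ 3 - 3/2 * s ^ 2 * (d - s) = 3/2 * (s - 2/3 * d) ^ 2 * (s + d / 3)"
    by (simp add: power2_eq_square power3_eq_cube field_simps)
  moreover have "0 \<le> 3/2 * (s - 2/3 * d) ^ 2 * (s + d / 3)"
    using d s by (intro mult_nonneg_nonneg) auto
  moreover have "(1 - x) - x - s = d - s" by (simp add: d_def)
  ultimately have 1: "3/2 * s ^ 2 * ((1 - x) - x - s) \<le> 2/9 * d ^ 3"
    by (metis diff_ge_0_iff_ge)
  have x_d: "x = (1 - d) / 2" by (simp add: d_def)
  have "cubic b (1/2) - cubic b x - 2/9 * d ^ 3
      = d * (3/8 - 3/2 * b + 3/4 * b ^ 2) + d ^ 2 * (3/8 - 2/9 * d + 3/4 * (b - b ^ 2)) + d ^ 3 * (1 + 2 * b ^ 2) / 8"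
    unfolding x_d by (simp add: cubic_def power2_eq_square power3_eq_cube field_simps)
  moreover have "0 \<le> 3/8 - 3/2 * b + 3/4 * b ^ 2" using b zero_le_power2[of b] by linarith
  moreover have "b ^ 2 \<le> b" using b mult_left_mono[of b 1 b] by (simp add: power2_eq_square)
  then have "0 \<le> 3/8 - 2/9 * d + 3/4 * (b - b ^ 2)"
    using d by (intro add_nonneg_nonneg) auto
  ultimately have "0 \<le> cubic b (1/2) - cubic b x - 2/9 * d ^ 3" using d by simp
  then show ?thesis using 1 cubic_le_peak[of b "1/2"] b by linarith
qed

text \<open>
  As \<open>cubic b 0 = 0\<close>, the identity \<open>cubic_peak_minus\<close> at \<open>x = 0\<close> gives the maximum in factored form.
\<close>
lemma cubic_peak_closed_form:
  assumes "1 \<le> (k :: real)"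
  shows "cubic (1 / (2 * k)) (peak (1 / (2 * k)))
    = (2 * k - 6 * k ^ 3 + 4 * k ^ 4 - k * sqrt (4 * k - 1) + 4 * k ^ 2 * sqrt (4 * k - 1)) / (2 * k ^ 2 + 1) ^ 2"
proof -
  define q where "q = sqrt (4 * k - 1)"
  define b where "b = 1 / (2 * k)"
  have k: "k > 0" using assms by simp
  have q2: "q * q = 4 * k - 1" using assms by (simp add: q_def)
  have "2 * b - b ^ 2 = (4 * k - 1) / (2 * k) ^ 2"
    using k by (simp add: b_def power2_eq_square field_simps)
  then have D: "sqrt (2 * b - b ^ 2) = q / (2 * k)"
    using k by (simp only: q_def real_sqrt_divide real_sqrt_abs)
  have den: "1 + 2 * b ^ 2 = (2 * k ^ 2 + 1) / (2 * k ^ 2)"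
    using k by (simp add: b_def power2_eq_square field_simps)
  have "peak b = ((2 * k + 1 - q) / (2 * k)) / ((2 * k ^ 2 + 1) / (2 * k ^ 2))"
  proof -
    have "1 + b - q / (2 * k) = (2 * k + 1 - q) / (2 * k)"
      using k by (simp add: b_def field_simps)
    then show ?thesis by (simp only: peak_def D den)
  qed
  also have "\<dots> = k * (2 * k + 1 - q) / (2 * k ^ 2 + 1)"
    using k by (simp add: power2_eq_square)
  finally have peak: "peak b = k * (2 * k + 1 - q) / (2 * k ^ 2 + 1)" .
  have "0 \<le> b" "b \<le> 2" using assms by (auto simp: b_def divide_simps)
  then have "cubic b (peak b) = peak b ^ 2 * (1 + b + 2 * (q / (2 * k)))"
    using cubic_peak_minus[of b 0] unfolding D by (simp add: cubic_def)
  also have "1 + b + 2 * (q / (2 * k)) = (2 * k + 1 + 2 * q) / (2 * k)"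
    using k by (simp add: b_def field_simps)
  also have "peak b ^ 2 * \<dots> = k * ((2 * k + 1 - q) ^ 2 * (2 * k + 1 + 2 * q)) / 2 / (2 * k ^ 2 + 1) ^ 2"
  proof -
    have "(k * v / c) ^ 2 * (w / (2 * k)) = k * (v ^ 2 * w) / 2 / c ^ 2" for v w c
      using k by (simp add: power2_eq_square mult_ac)
    then show ?thesis unfolding peak .
  qed
  also have "(2 * k + 1 - q) ^ 2 * (2 * k + 1 + 2 * q)
      = (2 * k + 1) ^ 3 - 3 * (2 * k + 1) * (q * q) + 2 * q * (q * q)"
    by (simp add: power2_eq_square power3_eq_cube algebra_simps)
  also have "k * \<dots> / 2 = 2 * k - 6 * k ^ 3 + 4 * k ^ 4 - k * q + 4 * k ^ 2 * q"
    unfolding q2 by (simp add: power2_eq_square power3_eq_cube power4_eq_xxxx field_simps)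
  finally show ?thesis by (simp add: b_def q_def)
qed

section \<open>The perturbed pattern\<close>

text \<open>
  The triples meeting \<open>A\<close> are bounded by \<open>power_sums_maclaurin\<close>, which produces the cubic at the total weight \<open>x\<close>
  of \<open>A\<close>; the square term that splitting \<open>B\<close> has cost is kept and played off against \<open>F\<close>.
\<close>
lemma lagrangian_complete_except_le_peak:
  fixes u :: "'a \<Rightarrow> real"
  assumes A: "finite A" "4 \<le> card A" and B: "finite B" "A \<inter> B = {}" "F \<subseteq> nsets B 3"
    and sparse: "\<And>W. W \<subseteq> B \<Longrightarrow> card W \<le> M \<Longrightarrow> card {e\<in>F. e \<subseteq> W} \<le> card W - 2"
    and u: "\<And>v. v \<in> A \<union> B \<Longrightarrow> 0 \<le> u v" "sum u (A \<union> B) = 1" "card {v\<in>A \<union> B. u v \<noteq> 0} \<le> M"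
  defines "b \<equiv> 1 / real (card A)"
  shows "6 * lagrangian (complete_except A B F) u \<le> cubic b (peak b)"
proof -
  define x where "x = sum u A"
  have y: "sum u B = 1 - x" using u(2) A B by (simp add: sum.union_disjoint x_def)
  have x: "0 \<le> x" "x \<le> 1" using u(1) y sum_nonneg[of B u] by (auto simp: x_def intro!: sum_nonneg)
  have b: "0 \<le> b" "b \<le> 1/4" using A by (auto simp: b_def divide_simps)
  \<comment> \<open>local sparsity is only available on the support of \<open>u\<close>\<close>
  define W where "W = {v\<in>B. u v \<noteq> 0}"
  have W: "finite W" "W \<subseteq> B" using B by (auto simp: W_def)
  have "card W \<le> card {v\<in>A \<union> B. u v \<noteq> 0}"
    using A B by (intro card_mono) (auto simp: W_def)
  then have cW: "card W' \<le> M" if "W' \<subseteq> W" for W'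
    using u(3) card_mono[OF W(1) that] by linarith
  define F' where "F' = {e\<in>F. e \<subseteq> W}"
  have F': "F' \<subseteq> nsets W 3" using B(3) by (auto simp: F'_def nsets_def)
  have "card {e\<in>F'. e \<subseteq> W'} \<le> card W' - 2" if "W' \<subseteq> W" for W'
  proof -
    have "{e\<in>F'. e \<subseteq> W'} = {e\<in>F. e \<subseteq> W'}" using that by (auto simp: F'_def)
    then show ?thesis using sparse[OF subset_trans[OF that W(2)] cW[OF that]] by simp
  qed
  then obtain s where s: "0 \<le> s"
    and F'_le: "6 * lagrangian F' u - 3 * x * (\<Sum>v\<in>W. u v ^ 2) \<le> 3/2 * s ^ 2 * (sum u W - x - s)"
    using sparse_lagrangian_bound[OF W(1) F', of u x] u(1) W(2) x(1) by blast
  have supp: "sum u W = sum u B" "(\<Sum>v\<in>W. u v ^ 2) = (\<Sum>v\<in>B. u v ^ 2)"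
    using B(1) by (auto simp: W_def intro!: sum.mono_neutral_left)
  have "lagrangian F u = lagrangian F' u"
    unfolding lagrangian_def
  proof (rule sum.mono_neutral_right)
    show "finite F" using B(1,3) finite_subset finite_imp_finite_nsets by blast
    show "\<forall>e\<in>F - F'. (\<Prod>v\<in>e. u v) = 0"
    proof
      fix e assume "e \<in> F - F'"
      then have "e \<subseteq> B" "finite e" "\<not> e \<subseteq> W" using B(3) by (auto simp: F'_def nsets_def)
      then show "(\<Prod>v\<in>e. u v) = 0" by (auto simp: W_def)
    qed
  qed (auto simp: F'_def)
  then have F_le: "6 * lagrangian F u - 3 * x * (\<Sum>v\<in>B. u v ^ 2) \<le> 3/2 * s ^ 2 * ((1 - x) - x - s)"
    using F'_le unfolding supp y by simp
  have pow: "b * x ^ 2 \<le> (\<Sum>v\<in>A. u v ^ 2)"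
    "x ^ 3 - 3 * x * (\<Sum>v\<in>A. u v ^ 2) + 2 * (\<Sum>v\<in>A. u v ^ 3) \<le> (1 - b) * (1 - 2 * b) * x ^ 3"
    using power_sums_maclaurin[of A u] A u(1) by (simp_all add: b_def x_def)
  have "(x ^ 2 - (\<Sum>v\<in>A. u v ^ 2)) * (1 - x) \<le> (1 - b) * x ^ 2 * (1 - x)"
    using pow(1) x by (intro mult_right_mono) (simp_all add: algebra_simps)
  moreover have "6 * lagrangian (complete_except A B F) u
    = (x ^ 3 - 3 * x * (\<Sum>v\<in>A. u v ^ 2) + 2 * (\<Sum>v\<in>A. u v ^ 3))
      + 3 * ((x ^ 2 - (\<Sum>v\<in>A. u v ^ 2)) * (1 - x))
      + 3 * x * (1 - x) ^ 2 + (6 * lagrangian F u - 3 * x * (\<Sum>v\<in>B. u v ^ 2))"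
    using lagrangian_complete_except[OF A(1) B, of u] by (simp add: x_def[symmetric] y algebra_simps)
  ultimately have "6 * lagrangian (complete_except A B F) u
      \<le> (1 - b) * (1 - 2 * b) * x ^ 3 + 3 * ((1 - b) * x ^ 2 * (1 - x))
      + 3 * x * (1 - x) ^ 2 + 3/2 * s ^ 2 * ((1 - x) - x - s)"
    using pow(2) F_le by linarith
  also have "\<dots> = cubic b x + 3/2 * s ^ 2 * ((1 - x) - x - s)"
    by (simp add: cubic_eq)
  also have "\<dots> \<le> cubic b (peak b)"
    using b x s by (rule cubic_perturbed_le_peak)
  finally show ?thesis .
qed

lemma lagrangian_complete_except_uniform:
  fixes x :: real
  assumes A: "finite A" "0 < card A" and B: "finite B" "A \<inter> B = {}" "F \<subseteq> nsets B 3" "0 < card B"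
  defines "b \<equiv> 1 / real (card A)" and "t \<equiv> real (card B)"
    and "w \<equiv> \<lambda>v. if v \<in> A then x / real (card A) else (1 - x) / real (card B)"
  shows "sum w (A \<union> B) = 1"
    and "6 * lagrangian (complete_except A B F) w
      = cubic b x - 3 * x * (1 - x) ^ 2 / t + 6 * real (card F) * ((1 - x) / t) ^ 3"
proof -
  have wA: "w v = b * x" if "v \<in> A" for v using that by (simp add: w_def b_def)
  have wB: "w v = (1 - x) / t" if "v \<in> B" for v using that B(2) by (auto simp: w_def t_def)
  have sA: "sum w A = x" "(\<Sum>v\<in>A. w v ^ 2) = b * x ^ 2" "(\<Sum>v\<in>A. w v ^ 3) = b ^ 2 * x ^ 3"
    using A wA by (auto simp: b_def power2_eq_square power3_eq_cube)
  have sB: "sum w B = 1 - x" "(\<Sum>v\<in>B. w v ^ 2) = (1 - x) ^ 2 / t"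
    using B wB by (auto simp: t_def power2_eq_square)
  show "sum w (A \<union> B) = 1" using A B sA sB by (simp add: sum.union_disjoint)
  have "(\<Prod>v\<in>e. w v) = ((1 - x) / t) ^ 3" if "e \<in> F" for e
  proof -
    have "e \<subseteq> B" "card e = 3" using that B(3) by (auto simp: nsets_def)
    then have "(\<Prod>v\<in>e. w v) = (\<Prod>v\<in>e. (1 - x) / t)" using wB by (intro prod.cong) auto
    then show ?thesis using \<open>card e = 3\<close> by simp
  qed
  then have "lagrangian F w = real (card F) * ((1 - x) / t) ^ 3"
    by (simp add: lagrangian_def)
  then show "6 * lagrangian (complete_except A B F) w
      = cubic b x - 3 * x * (1 - x) ^ 2 / t + 6 * real (card F) * ((1 - x) / t) ^ 3"
    unfolding lagrangian_complete_except[OF A(1) B(1-3)] sA sB cubic_eq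
    by (simp add: power2_eq_square power3_eq_cube algebra_simps)
qed

text \<open>
  The contribution of \<open>F\<close> at the uniform weights exceeds the loss if \<open>2 |F| (1 - x) > x t^2\<close>
  at the peak \<open>x\<close>; a system with \<open>|F| \<ge> C t^2\<close> for \<open>C = x/(1 - x)\<close> leaves a factor of 2 to spare.
\<close>
theorem cubic_peak_non_jump:
  fixes m :: nat
  assumes m: "4 \<le> m"
  defines "b \<equiv> 1 / real m"
  shows "non_jump 3 (cubic b (peak b))"
proof (rule non_jump_criterion[where 'a = nat])
  have b: "0 < b" "b \<le> 1/4" using m by (auto simp: b_def divide_simps)
  have peak01: "0 < peak b" "peak b < 1" using peak_bounds[of b] b by auto
  show "cubic b (peak b) < 1" using cubic_less_1[of b "peak b"] b peak01 by simp
  show "0 \<le> cubic b (peak b)" using cubic_le_peak[of b 0] b by (simp add: cubic_def)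
  fix M
  define C where "C = peak b / (1 - peak b)"
  have C: "0 < C" using peak01 by (simp add: C_def)
  obtain t F where t: "t > 0" and F: "F \<subseteq> nsets {..<t} 3" "C * real t ^ 2 \<le> real (card F)"
    and sparse: "\<And>W. W \<subseteq> {..<t} \<Longrightarrow> card W \<le> M \<Longrightarrow> card {e\<in>F. e \<subseteq> W} \<le> card W - 2"
    using sparse_triple_system_exists[OF less_imp_le[OF C], of M] by blast
  define A where "A = {t..<t + m}"
  define B where "B = {..<t}"
  have AB: "finite A" "card A = m" "finite B" "A \<inter> B = {}" "card B = t"
    by (auto simp: A_def B_def)
  have FB: "F \<subseteq> nsets B 3" using F(1) by (simp add: B_def)
  define w where "w = (\<lambda>v. if v \<in> A then peak b / real (card A) else (1 - peak b) / real (card B))"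
  have "uniform_graph 3 (A \<union> B) (complete_except A B F)"
    using AB FB nsets_mono[of B "A \<union> B" 3] by (auto simp: uniform_graph_def complete_except_def)
  moreover have "\<forall>v\<in>A \<union> B. 0 \<le> w v" using peak01 by (simp add: w_def)
  moreover have "sum w (A \<union> B) = 1"
    unfolding w_def using lagrangian_complete_except_uniform(1)[of A B F "peak b"] AB FB m t by simp
  moreover have "cubic b (peak b) < fact 3 * lagrangian (complete_except A B F) w"
  proof -
    define p where "p = peak b"
    have p: "0 < p" "p < 1" using peak01 by (simp_all add: p_def)
    have "6 * lagrangian (complete_except A B F) w
        = cubic b p - 3 * p * (1 - p) ^ 2 / t + 6 * real (card F) * ((1 - p) / t) ^ 3"
      unfolding w_def p_def[symmetric] using lagrangian_complete_except_uniform(2)[of A B F p] AB FB m t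
      by (simp add: b_def)
    moreover have "6 * (C * real t ^ 2) * ((1 - p) / t) ^ 3 \<le> 6 * real (card F) * ((1 - p) / t) ^ 3"
      using F(2) p by (intro mult_right_mono) auto
    moreover have "6 * (C * real t ^ 2) * ((1 - p) / t) ^ 3 = 6 * p * (1 - p) ^ 2 / t"
      using p t by (simp add: C_def p_def[symmetric] power2_eq_square power3_eq_cube field_simps)
    moreover have "0 < p * (1 - p) ^ 2 / t" using p t by simp
    ultimately show ?thesis by (simp add: fact_numeral p_def[symmetric])
  qed
  moreover have "fact 3 * lagrangian (complete_except A B F) u \<le> cubic b (peak b)"
    if "\<forall>v\<in>A \<union> B. 0 \<le> u v" "sum u (A \<union> B) = 1" "card {v\<in>A \<union> B. u v \<noteq> 0} \<le> M" for u
    using lagrangian_complete_except_le_peak[of A B F M u] that AB FB sparse m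
    by (simp add: fact_numeral b_def B_def)
  ultimately show "\<exists>(V :: nat set) E w. uniform_graph 3 V E \<and>
          (\<forall>v\<in>V. 0 \<le> w v) \<and> sum w V = 1 \<and> cubic b (peak b) < fact 3 * lagrangian E w \<and>
          (\<forall>u. (\<forall>v\<in>V. 0 \<le> u v) \<longrightarrow> sum u V = 1 \<longrightarrow> card {v\<in>V. u v \<noteq> 0} \<le> M
             \<longrightarrow> fact 3 * lagrangian E u \<le> cubic b (peak b))"
    by blast
qed simp

theorem theorem1p5:
  fixes k :: nat
  assumes "k \<ge> 2"
  shows "non_jump 3
    ((2 * real k - 6 * real k ^ 3 + 4 * real k ^ 4
        - real k * sqrt (4 * real k - 1) + 4 * real k ^ 2 * sqrt (4 * real k - 1))
      / (2 * real k ^ 2 + 1) ^ 2)"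
  using cubic_peak_non_jump[of "2 * k"] cubic_peak_closed_form[of "real k"] assms by simp

end
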